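(* Let $(\sigma,\pi)\in\mathbb{N}^m\times\mathbb{N}^n$ be a weight pair of degree $d$ (that is, $\sum_i\sigma_i=\sum_j\pi_j=d$) and fix $(k,\ell)\in[m]\times[n]$. Let $\psi^{\sigma,\pi}_{k\ell}:R_{\sigma,\pi}\to R_{\sigma+\vec e_k,\pi+\vec e_\ell}$ be the linear map given by multiplication by the variable $z_{k\ell}$. Then $\psi^{\sigma,\pi}_{k\ell}$ is an RSK-commuting isomorphism if and only if $$\sigma_k+\pi_\ell\geq d.$$
   Context: $\mathbb{N}=\{0,1,2,\dots\}$, $[m]=\{1,\dots,m\}$, and $\vec e_k$, $\vec e_\ell$ are standard basis vectors. RSK. A semistandard Young tableau is a filling of a Young diagram (English notation) by positive integers, weakly increasing along rows and strictly increasing down columns. Row insertion $P\leftarrow p$: if no label in the first row of $P$ exceeds $p$, append $p$ to the end of the first row; otherwise replace the leftmost occurrence of the smallest label $p'>p$ of the first row by $p$, and insert $p'$ in the same way into the tableau formed by the remaining rows. Inserting a biletter $(p|q)$ into a pair $(P,Q)$ of tableaux of the same shape yields $(P\leftarrow p,Q^\uparrow)$, where $Q^\uparrow$ is $Q$ with a new box labelled $q$ placed where $P\leftarrow p$ has a new box. For an $m\times n$ matrix $\alpha$ with entries in $\mathbb{N}$, list biletters by reading the entries of $\alpha$ down columns, columns from left to right, recording $\alpha_{i,j}$ copies of $(i|j)$. $\mathrm{RSK}(\alpha)=(P,Q)$ is the result of inserting these biletters successively into $(\emptyset,\emptyset)$. Operator. Let $R_{m,n}=\mathbb{C}[z_{ij}]_{1\le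 i\le m,1\le j\le n}$, $Z=[z_{ij}]$, and $z^\alpha=\prod_{i,j} z_{ij}^{\alpha_{i,j}}$. For semistandard $P,Q$ of the same shape, $[P|Q]\in R_{m,n}$ is the product over column positions $c$ of the minors of $Z$ whose row indices are the entries of the $c$-th column of $P$ and whose column indices are the entries of the $c$-th column of $Q$. Let $\mathsf{RSK}:R_{m,n}\to R_{m,n}$ be the linear map with $z^\alpha\mapsto[P|Q]$ where $(P,Q)=\mathrm{RSK}(\alpha)$. Weight spaces. $R_{\sigma,\pi}=R_{m,n,\sigma,\pi}$ is the span of the monomials $z^\alpha$ such that $\alpha$ has row sums $\sigma$ and column sums $\pi$. $\mathsf{RSK}$ maps $R_{\sigma,\pi}$ to itself; $\mathsf{RSK}_{\sigma,\pi}$ is the restriction. A linear map $\psi:R_{\sigma,\pi}\to R_{\widetilde\sigma,\widetilde\pi}$ is RSK-commuting if $\psi\circ\mathsf{RSK}_{\sigma,\pi}=\mathsf{RSK}_{\widetilde\sigma,\widetilde\pi}\circ\psi$. *)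

theory Defs
  imports Complex_Main "HOL-Library.Poly_Mapping" "Jordan_Normal_Form.Determinant"
begin

section \<open>RSK\<close>

text \<open>
  A tableau is the list of its rows. The first equation also covers the insertion below the
  last row.
\<close>

fun tableau_insert :: "nat list list \<Rightarrow> nat \<Rightarrow> nat list list" where
  "tableau_insert [] p = [[p]]"
| "tableau_insert (r # P) p =
    (if \<forall>x\<in>set r. x \<le> p then (r @ [p]) # P
     else let p' = Min {x \<in> set r. p < x} in
       r[(LEAST i. i < length r \<and> r ! i = p') := p] # tableau_insert P p')"

text \<open>
  \<open>add_box P' Q q\<close> adds a box labelled \<open>q\<close> to \<open>Q\<close>, in the first row where \<open>P'\<close> is longer
  than \<open>Q\<close>. In RSK, \<open>P'\<close> has exactly one box more than \<open>Q\<close>.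
\<close>

fun add_box :: "nat list list \<Rightarrow> nat list list \<Rightarrow> nat \<Rightarrow> nat list list" where
  "add_box [] Q q = Q"
| "add_box (r # P') [] q = [[q]]"
| "add_box (r # P') (s # Q) q =
    (if length s < length r then (s @ [q]) # Q else s # add_box P' Q q)"

fun biletter_insert ::
  "nat list list \<times> nat list list \<Rightarrow> nat \<times> nat \<Rightarrow> nat list list \<times> nat list list" where
  "biletter_insert (P, Q) (p, q) = (tableau_insert P p, add_box (tableau_insert P p) Q q)"

text \<open>
  An \<open>m \<times> n\<close> matrix over the natural numbers is an exponent of a monomial: a finitely supported
  function on pairs, of which only the entries with index in \<open>{1..m} \<times> {1..n}\<close> are used.
\<close>

type_synonym expo = "(nat \<times> nat) \<Rightarrow>\<^sub>0 nat"

definition biword :: "nat \<Rightarrow> nat \<Rightarrow> expo \<Rightarrow> (nat \<times> nat) list" where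
  "biword m n \<alpha> =
    concat [replicate (Poly_Mapping.lookup \<alpha> (i, j)) (i, j). j \<leftarrow> [1..<Suc n], i \<leftarrow> [1..<Suc m]]"

definition rsk :: "nat \<Rightarrow> nat \<Rightarrow> expo \<Rightarrow> nat list list \<times> nat list list" where
  "rsk m n \<alpha> = foldl biletter_insert ([], []) (biword m n \<alpha>)"


section \<open>The operator\<close>

text \<open>
  Polynomials are finitely supported functions from exponents to coefficients, with the
  convolution product. All variables \<open>z\<^sub>i\<^sub>j\<close> with \<open>i, j\<close> natural numbers live in one type;
  the polynomial ring in the entries of an \<open>m \<times> n\<close> matrix is the subspace spanned by the monomials
  with exponents supported on \<open>{1..m} \<times> {1..n}\<close>.
\<close>

type_synonym zpoly = "expo \<Rightarrow>\<^sub>0 complex"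

definition zmonom :: "expo \<Rightarrow> zpoly" where
  "zmonom \<alpha> = Poly_Mapping.single \<alpha> 1"

definition zvar :: "nat \<Rightarrow> nat \<Rightarrow> zpoly" where
  "zvar i j = zmonom (Poly_Mapping.single (i, j) 1)"

definition scale :: "complex \<Rightarrow> zpoly \<Rightarrow> zpoly" where
  "scale c f = Poly_Mapping.map ((*) c) f"

lemma lookup_scale [simp]: "Poly_Mapping.lookup (scale c f) \<alpha> = c * Poly_Mapping.lookup f \<alpha>"
  by (simp add: scale_def map.rep_eq when_def)

global_interpretation zpoly: vector_space scale
  by unfold_locales (auto intro!: poly_mapping_eqI simp: lookup_add algebra_simps)

definition minor :: "nat list \<Rightarrow> nat list \<Rightarrow> zpoly" where
  "minor rs cs = det (mat (length rs) (length cs) (\<lambda>(a, b). zvar (rs ! a) (cs ! b)))"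

text \<open>\<open>List.transpose\<close> turns the list of rows of a tableau into the list of its columns.\<close>

definition bitableau :: "nat list list \<Rightarrow> nat list list \<Rightarrow> zpoly" where
  "bitableau P Q = prod_list (map2 minor (List.transpose P) (List.transpose Q))"

text \<open>
  The linear extension of \<open>z\<^sup>\<alpha> \<mapsto> [P|Q]\<close>; it is only meant to be applied to polynomials
  in the variables \<open>z\<^sub>i\<^sub>j\<close> with \<open>(i, j)\<close> in \<open>{1..m} \<times> {1..n}\<close>.
\<close>

definition RSK_op :: "nat \<Rightarrow> nat \<Rightarrow> zpoly \<Rightarrow> zpoly" where
  "RSK_op m n f =
    (\<Sum>\<alpha>\<in>Poly_Mapping.keys f. scale (Poly_Mapping.lookup f \<alpha>) (case rsk m n \<alpha> of (P, Q) \<Rightarrow> bitableau P Q))"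

lemma RSK_op_zmonom: "RSK_op m n (zmonom \<alpha>) = (case rsk m n \<alpha> of (P, Q) \<Rightarrow> bitableau P Q)"
  by (simp add: RSK_op_def zmonom_def)

lemma RSK_op_linear: "Vector_Spaces.linear scale scale (RSK_op m n)"
proof -
  define b where "b \<alpha> = (case rsk m n \<alpha> of (P, Q) \<Rightarrow> bitableau P Q)" for \<alpha>
  have eq: "RSK_op m n f = (\<Sum>\<alpha>\<in>A. scale (Poly_Mapping.lookup f \<alpha>) (b \<alpha>))"
    if "finite A" "Poly_Mapping.keys f \<subseteq> A" for f A
    unfolding RSK_op_def b_def using that
    by (intro sum.mono_neutral_left) (auto simp: in_keys_iff)
  have add: "RSK_op m n (f + g) = RSK_op m n f + RSK_op m n g" for f g
  proof -
    let ?A = "Poly_Mapping.keys f \<union> Poly_Mapping.keys g"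
    have "Poly_Mapping.keys (f + g) \<subseteq> ?A" by (rule Poly_Mapping.keys_add)
    then show ?thesis
      by (simp add: eq[of ?A] lookup_add zpoly.scale_left_distrib sum.distrib)
  qed
  have scl: "RSK_op m n (scale c f) = scale c (RSK_op m n f)" for c f
  proof -
    have "Poly_Mapping.keys (scale c f) \<subseteq> Poly_Mapping.keys f"
      by (auto simp: in_keys_iff)
    then show ?thesis
      by (simp add: eq[of "Poly_Mapping.keys f"] zpoly.scale_sum_right)
  qed
  show ?thesis
    by unfold_locales (simp_all add: add scl)
qed


section \<open>Weight spaces\<close>

text \<open>
  Vectors of length \<open>m\<close> are functions on the natural numbers, of which only the values on
  \<open>{1..m}\<close> are used.
\<close>

definition weight_space :: "nat \<Rightarrow> nat \<Rightarrow> (nat \<Rightarrow> nat) \<Rightarrow> (nat \<Rightarrow> nat) \<Rightarrow> zpoly set" where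
  "weight_space m n \<sigma> \<pi> = zpoly.span {zmonom \<alpha> |\<alpha>.
     Poly_Mapping.keys \<alpha> \<subseteq> {1..m} \<times> {1..n} \<and>
     (\<forall>i\<in>{1..m}. (\<Sum>j=1..n. Poly_Mapping.lookup \<alpha> (i, j)) = \<sigma> i) \<and>
     (\<forall>j\<in>{1..n}. (\<Sum>i=1..m. Poly_Mapping.lookup \<alpha> (i, j)) = \<pi> j)}"

definition add_unit :: "(nat \<Rightarrow> nat) \<Rightarrow> nat \<Rightarrow> nat \<Rightarrow> nat" where
  "add_unit \<sigma> k = (\<lambda>i. \<sigma> i + (if i = k then 1 else 0))"

definition linear_map :: "zpoly set \<Rightarrow> zpoly set \<Rightarrow> (zpoly \<Rightarrow> zpoly) \<Rightarrow> bool" where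
  "linear_map V W \<psi> \<longleftrightarrow> \<psi> ` V \<subseteq> W \<and>
     (\<forall>f\<in>V. \<forall>g\<in>V. \<psi> (f + g) = \<psi> f + \<psi> g) \<and>
     (\<forall>c. \<forall>f\<in>V. \<psi> (scale c f) = scale c (\<psi> f))"

definition linear_iso :: "zpoly set \<Rightarrow> zpoly set \<Rightarrow> (zpoly \<Rightarrow> zpoly) \<Rightarrow> bool" where
  "linear_iso V W \<psi> \<longleftrightarrow> linear_map V W \<psi> \<and> bij_betw \<psi> V W"

definition RSK_commuting ::
  "nat \<Rightarrow> nat \<Rightarrow> zpoly set \<Rightarrow> zpoly set \<Rightarrow> (zpoly \<Rightarrow> zpoly) \<Rightarrow> bool" where
  "RSK_commuting m n V W \<psi> \<longleftrightarrow>
     linear_map V W \<psi> \<and> (\<forall>f\<in>V. \<psi> (RSK_op m n f) = RSK_op m n (\<psi> f))"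

definition mult_var :: "nat \<Rightarrow> nat \<Rightarrow> zpoly \<Rightarrow> zpoly" where
  "mult_var k l f = zvar k l * f"

end

theory Submission
  imports Defs
begin

text \<open>
  Let \<open>N = \<alpha>\<^sub>k\<^sub>l\<close>. If \<open>\<sigma>\<^sub>k + \<pi>\<^sub>l \<ge> d\<close>, then the entries of \<open>\<alpha>\<close> outside row \<open>k\<close> and column \<open>l\<close>
  add up to at most \<open>N\<close>. Hence, once the letters \<open>k\<close> of column \<open>l\<close> have been inserted, the first row
  of \<open>P\<close> has no letter above \<open>k\<close>, and one more biletter \<open>(k|l)\<close> is appended to both first rows. The
  first row of \<open>P\<close> then contains at least \<open>N\<close> letters \<open>k\<close>, while at most \<open>N\<close> later letters are below
  \<open>k\<close>; so a later insertion never bumps the extra \<open>k\<close> differently from the old ones, and at the end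
  the two runs differ only by one \<open>k\<close> and one \<open>l\<close> in the first rows. Moreover the first row of \<open>P\<close>
  has at least \<open>\<sigma>\<^sub>k\<close> letters up to \<open>k\<close> and length at least \<open>\<pi>\<^sub>l\<close>, and symmetrically for \<open>Q\<close>, so the
  other rows have length at most \<open>min \<sigma>\<^sub>k \<pi>\<^sub>l\<close>. The two extra letters can thus be placed in a common
  new column of height one, which contributes the factor \<open>z\<^sub>k\<^sub>l\<close>.

  Multiplication by \<open>z\<^sub>k\<^sub>l\<close> is always injective. It is onto the larger weight space iff no matrix with
  the margins \<open>\<sigma> + e\<^sub>k, \<pi> + e\<^sub>l\<close> has a zero \<open>(k, l)\<close>-entry, that is, iff \<open>\<sigma>\<^sub>k + \<pi>\<^sub>l \<ge> d\<close>.
\<close>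

section \<open>Row insertion\<close>

text \<open>
  For a sorted row this is the first row after insertion; if nothing is bumped, then \<open>tl []\<close> is
  \<open>[]\<close> and \<open>p\<close> is appended.
\<close>

definition row_insert :: "nat list \<Rightarrow> nat \<Rightarrow> nat list" where
  "row_insert r p = takeWhile (\<lambda>x. x \<le> p) r @ p # tl (dropWhile (\<lambda>x. x \<le> p) r)"

lemma sorted_split_le:
  fixes r :: "nat list"
  assumes "sorted r"
  obtains x z where "r = x @ z" "\<forall>a\<in>set x. a \<le> p" "\<forall>a\<in>set z. p < a"
    "takeWhile (\<lambda>a. a \<le> p) r = x" "dropWhile (\<lambda>a. a \<le> p) r = z" "sorted x" "sorted z"
proof -
  have "\<forall>a\<in>set (dropWhile (\<lambda>a. a \<le> p) r). p < a"
    using assms by (induction r) (auto intro: less_le_trans)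
  then show thesis
    using that[of "takeWhile (\<lambda>a. a \<le> p) r" "dropWhile (\<lambda>a. a \<le> p) r"] assms
    by (auto dest: set_takeWhileD simp: sorted_takeWhile sorted_dropWhile)
qed

lemma row_insert_append:
  assumes "\<forall>a\<in>set x. a \<le> p" "\<forall>a\<in>set z. p < a"
  shows "row_insert (x @ z) p = x @ p # tl z"
proof -
  have "takeWhile (\<lambda>a. a \<le> p) z = []" "dropWhile (\<lambda>a. a \<le> p) z = z"
    using assms(2) by (cases z; auto)+
  then show ?thesis using assms(1) by (simp add: row_insert_def)
qed

lemma row_insert_snoc: "\<forall>a\<in>set r. a \<le> p \<Longrightarrow> row_insert r p = r @ [p]"
  using row_insert_append[of r p "[]"] by simp

lemma row_insert_cases:
  assumes "sorted r"
  obtains (append) "\<forall>a\<in>set r. a \<le> p" "row_insert r p = r @ [p]" "dropWhile (\<lambda>a. a \<le> p) r = []"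
  | (bump) x p' y where "r = x @ p' # y" "\<forall>a\<in>set x. a \<le> p" "p < p'" "\<forall>a\<in>set y. p < a"
      "row_insert r p = x @ p # y" "dropWhile (\<lambda>a. a \<le> p) r = p' # y"
proof -
  obtain x z where "r = x @ z" "\<forall>a\<in>set x. a \<le> p" "\<forall>a\<in>set z. p < a"
    "dropWhile (\<lambda>a. a \<le> p) r = z"
    using sorted_split_le[OF assms, of p] by metis
  then show thesis
    using append bump row_insert_snoc[of x p] row_insert_append[of x p z] by (cases z) auto
qed

lemma sorted_row_insert:
  assumes "sorted r"
  shows "sorted (row_insert r p)"
  using assms(1)
proof (cases rule: row_insert_cases[of r p])
  case (bump x p' y)
  then show ?thesis using assms by (fastforce simp: sorted_append)
qed (use assms in \<open>simp add: sorted_append\<close>)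

lemma sorted_foldl_row_insert: "sorted r \<Longrightarrow> sorted (foldl row_insert r w)"
  by (induction w arbitrary: r) (auto simp: sorted_row_insert)

text \<open>In a sorted row the first letter above \<open>p\<close> is also the least one. Its
  leftmost occurrence is at \<open>length x\<close>, because all letters of \<open>x\<close> are at
  most \<open>p\<close>.\<close>

lemma tableau_insert_bump:
  assumes "sorted (x @ p' # y)" "\<forall>a\<in>set x. a \<le> p" "p < p'"
  shows "tableau_insert ((x @ p' # y) # T) p = (x @ p # y) # tableau_insert T p'"
proof -
  have Min: "Min {a \<in> set (x @ p' # y). p < a} = p'"
    using assms by (intro Min_eqI) (auto simp: sorted_append)
  have "(LEAST i. i < length (x @ p' # y) \<and> (x @ p' # y) ! i = p') = length x"
  proof (rule Least_equality)
    fix i assume i: "i < length (x @ p' # y) \<and> (x @ p' # y) ! i = p'"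
    show "length x \<le> i"
    proof (rule ccontr)
      assume "\<not> length x \<le> i"
      then have "p' \<in> set x" using i by (auto simp: nth_append)
      then show False using assms by auto
    qed
  qed auto
  then show ?thesis using assms(3) Min by (auto simp: Let_def)
qed

lemma length_takeWhile_dropWhile: "length r = length (takeWhile Q r) + length (dropWhile Q r)"
  by (metis length_append takeWhile_dropWhile_id)

lemma length_row_insert_bump:
  "dropWhile (\<lambda>a. a \<le> p) r = p' # y \<Longrightarrow> length (row_insert r p) = length r"
  using length_takeWhile_dropWhile[of r "\<lambda>a. a \<le> p"] by (simp add: row_insert_def)

lemma biletter_insert_append:
  assumes "\<forall>a\<in>set r. a \<le> p" "length s = length r"
  shows "biletter_insert (r # T, s # U) (p, q) = ((r @ [p]) # T, (s @ [q]) # U)"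
  using assms by simp

text \<open>A bump preserves the length of the first row, so \<open>add_box\<close> passes on to the
  lower rows. These see of the first row only the bumped letter \<open>p'\<close>; two first rows
  that bump the same letter therefore have the same effect below.\<close>

lemma biletter_insert_bump:
  assumes "sorted r" "dropWhile (\<lambda>a. a \<le> p) r = p' # y" "length s = length r"
  shows "biletter_insert (r # T, s # U) (p, q) =
    (row_insert r p # tableau_insert T p', s # add_box (tableau_insert T p') U q)"
proof -
  obtain x z where r: "r = x @ z" "\<forall>a\<in>set x. a \<le> p" "\<forall>a\<in>set z. p < a"
    "dropWhile (\<lambda>a. a \<le> p) r = z"
    using sorted_split_le[OF assms(1), of p] by metis
  then have z: "z = p' # y" using assms by simp
  have "tableau_insert (r # T) p = row_insert r p # tableau_insert T p'"
    using tableau_insert_bump[of x p' y p T] assms(1) r row_insert_append[of x p z] unfolding z by auto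
  moreover have "length (row_insert r p) = length r"
    using r row_insert_append[of x p z] unfolding z by auto
  ultimately show ?thesis using assms(3) by simp
qed

lemma dropWhile_le_Nil: "dropWhile (\<lambda>a. a \<le> p) r = [] \<longleftrightarrow> (\<forall>a\<in>set r. a \<le> (p::nat))"
  by (simp add: dropWhile_eq_Nil_conv)

section \<open>Sizes and shapes of the two tableaux\<close>

lemma sum_length_tableau_insert:
  "(\<Sum>t\<leftarrow>tableau_insert P p. length t) = Suc (\<Sum>t\<leftarrow>P. length t)"
  by (induction P p rule: tableau_insert.induct) (auto simp: Let_def)

lemma shape_add_box:
  "map length P = map length Q \<Longrightarrow>
    map length (add_box (tableau_insert P p) Q q) = map length (tableau_insert P p)"
proof (induction P p arbitrary: Q rule: tableau_insert.induct)
  case (2 r P p)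
  then obtain s U where "Q = s # U" "length s = length r" "map length P = map length U"
    by (cases Q) auto
  then show ?case using 2 by (auto simp: Let_def)
qed auto

lemma sum_length_biletter_insert:
  "(\<Sum>t\<leftarrow>fst (foldl biletter_insert (P, Q) w). length t) = (\<Sum>t\<leftarrow>P. length t) + length w"
proof (induction w arbitrary: P Q)
  case (Cons b w)
  then show ?case by (cases b) (simp add: sum_length_tableau_insert)
qed simp

lemma shape_biletter_insert:
  "map length P = map length Q \<Longrightarrow>
    map length (fst (foldl biletter_insert (P, Q) w)) = map length (snd (foldl biletter_insert (P, Q) w))"
proof (induction w arbitrary: P Q)
  case (Cons b w)
  then show ?case by (cases b) (simp add: shape_add_box)
qed simp

section \<open>Letter counts of the first row under insertion of letters and words\<close>

lemma length_filter_le_row_insert_same: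
  assumes "sorted r"
  shows "length (filter (\<lambda>a. a \<le> p) (row_insert r p)) = Suc (length (filter (\<lambda>a. a \<le> p) r))"
  using assms by (cases rule: row_insert_cases[of r p]) (auto)

lemma length_filter_le_row_insert:
  assumes "sorted r"
  shows "length (filter (\<lambda>a. a \<le> t) r) \<le> length (filter (\<lambda>a. a \<le> t) (row_insert r p))"
  using assms by (cases rule: row_insert_cases[of r p]) (auto)

lemma length_filter_less_row_insert:
  assumes "sorted r"
  shows "length (filter (\<lambda>a. a < t) (row_insert r p))
    \<le> length (filter (\<lambda>a. a < t) r) + (if p < t then 1 else 0)"
  using assms by (cases rule: row_insert_cases[of r p]) (auto)

lemma length_filter_gt_row_insert:
  assumes "sorted r"
  shows "length (filter (\<lambda>a. t < a) (row_insert r p))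
    \<le> length (filter (\<lambda>a. t < a) r) + (if t < p then 1 else 0)"
  using assms by (cases rule: row_insert_cases[of r p]) (auto)

text \<open>The bumped letter is above \<open>p\<close>; truncated subtraction covers the case in
  which \<open>p\<close> is appended.\<close>

lemma length_filter_gt_row_insert_same:
  assumes "sorted r"
  shows "length (filter (\<lambda>a. p < a) (row_insert r p)) = length (filter (\<lambda>a. p < a) r) - 1"
  using assms by (cases rule: row_insert_cases[of r p]) (auto simp: not_less intro: less_imp_le)

text \<open>Only one letter is bumped, and it is larger than \<open>p\<close>, so a \<open>k\<close>
  can get lost only to a smaller letter.\<close>

lemma count_list_row_insert:
  assumes "sorted r"
  shows "count_list r k \<le> count_list (row_insert r p) k + (if p < k then 1 else 0)"
  using assms by (cases rule: row_insert_cases[of r p]) (auto)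

lemma count_list_row_insert_same:
  assumes "sorted r"
  shows "count_list (row_insert r k) k = Suc (count_list r k)"
  using assms by (cases rule: row_insert_cases[of r k]) (auto)

lemma length_filter_le_foldl:
  "sorted r \<Longrightarrow> length (filter (\<lambda>a. a \<le> t) r) + count_list w t
    \<le> length (filter (\<lambda>a. a \<le> t) (foldl row_insert r w))"
proof (induction w arbitrary: r)
  case (Cons p w)
  then show ?case
    using Cons.IH[OF sorted_row_insert[OF Cons.prems, of p]] length_filter_le_row_insert[OF Cons.prems, of t p]
      length_filter_le_row_insert_same[OF Cons.prems, of p]
    by (auto split: if_splits)
qed simp

lemma length_filter_less_foldl:
  "sorted r \<Longrightarrow> length (filter (\<lambda>a. a < t) (foldl row_insert r w))
    \<le> length (filter (\<lambda>a. a < t) r) + length (filter (\<lambda>a. a < t) w)"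
proof (induction w arbitrary: r)
  case (Cons p w)
  then show ?case
    using Cons.IH[OF sorted_row_insert[OF Cons.prems, of p]] length_filter_less_row_insert[OF Cons.prems, of t p]
    by (auto split: if_splits)
qed simp

lemma length_filter_gt_foldl:
  "sorted r \<Longrightarrow> length (filter (\<lambda>a. t < a) (foldl row_insert r w))
    \<le> length (filter (\<lambda>a. t < a) r) + length (filter (\<lambda>a. t < a) w)"
proof (induction w arbitrary: r)
  case (Cons p w)
  then show ?case
    using Cons.IH[OF sorted_row_insert[OF Cons.prems, of p]] length_filter_gt_row_insert[OF Cons.prems, of t p]
    by (auto split: if_splits)
qed simp

lemma count_list_foldl:
  "sorted r \<Longrightarrow> count_list r k \<le> count_list (foldl row_insert r w) k + length (filter (\<lambda>a. a < k) w)"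
proof (induction w arbitrary: r)
  case (Cons p w)
  then show ?case
    using Cons.IH[OF sorted_row_insert[OF Cons.prems, of p]] count_list_row_insert[OF Cons.prems, of k p]
    by (auto split: if_splits)
qed simp

text \<open>Each inserted \<open>k\<close> bumps one of the letters above \<open>k\<close> as long
  as there are any, and never another \<open>k\<close>.\<close>

lemma foldl_row_insert_replicate:
  assumes "sorted r"
  shows "length (filter (\<lambda>a. k < a) (foldl row_insert r (replicate N k))) = length (filter (\<lambda>a. k < a) r) - N"
    and "count_list (foldl row_insert r (replicate N k)) k = count_list r k + N"
  using assms
  by (induction N arbitrary: r)
     (auto simp: sorted_row_insert length_filter_gt_row_insert_same count_list_row_insert_same)

lemma length_filter_le_mono: "p \<le> t \<Longrightarrow>
    length (filter (\<lambda>a. a \<le> p) r) \<le> length (filter (\<lambda>a. a \<le> (t::nat)) r)"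
  by (induction r) auto

text \<open>In a weakly increasing word no letter bumps an earlier one. The induction takes the last
  letter \<open>p\<close> as the bound for the preceding word, since inserting \<open>p\<close>
  removes no letter up to \<open>p\<close>.\<close>

lemma length_foldl_row_insert_sorted:
  assumes "sorted r" "sorted w" "\<forall>a\<in>set w. a \<le> t"
  shows "length w \<le> length (filter (\<lambda>a. a \<le> t) (foldl row_insert r w))"
  using assms(2,3)
proof (induction w arbitrary: t rule: rev_induct)
  case (snoc p w)
  let ?r = "foldl row_insert r w"
  have "length w \<le> length (filter (\<lambda>a. a \<le> p) ?r)"
    using snoc.prems by (intro snoc.IH) (auto simp: sorted_append)
  then have "Suc (length w) \<le> length (filter (\<lambda>a. a \<le> p) (row_insert ?r p))"
    using assms(1) by (simp add: length_filter_le_row_insert_same sorted_foldl_row_insert)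
  also have "\<dots> \<le> length (filter (\<lambda>a. a \<le> t) (row_insert ?r p))"
    using snoc.prems by (simp add: length_filter_le_mono)
  finally show ?case by simp
qed simp

text \<open>The first row of \<open>P\<close> evolves independently of the lower rows, while that of
  \<open>Q\<close> only grows at its end. The list \<open>y\<close> holds the labels added during
  \<open>w\<close>; if \<open>w\<close> lies within one matrix column, \<open>y\<close> is
  constant.\<close>

lemma foldl_biletter_insert_first_row:
  assumes "sorted r" "length s = length r"
  obtains T' y U' where
    "foldl biletter_insert (r # T, s # U) w = (foldl row_insert r (map fst w) # T', (s @ y) # U')"
    "length (s @ y) = length (foldl row_insert r (map fst w))" "set y \<subseteq> snd ` set w"
proof -
  have "\<exists>T' y U'.
    foldl biletter_insert (r # T, s # U) w = (foldl row_insert r (map fst w) # T', (s @ y) # U') \<and>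
    length (s @ y) = length (foldl row_insert r (map fst w)) \<and> set y \<subseteq> snd ` set w"
    using assms
  proof (induction w arbitrary: r s T U)
    case (Cons b w)
    obtain p q where b: "b = (p, q)" by force
    show ?case
    proof (cases "dropWhile (\<lambda>a. a \<le> p) r")
      case Nil
      then have le: "\<forall>a\<in>set r. a \<le> p" by (simp only: dropWhile_le_Nil)
      have "length (s @ [q]) = length (row_insert r p)" using Cons.prems by (simp add: row_insert_snoc[OF le])
      from Cons.IH[OF sorted_row_insert[OF Cons.prems(1)] this, of T U] obtain T' y U' where
        "foldl biletter_insert (row_insert r p # T, (s @ [q]) # U) w =
           (foldl row_insert (row_insert r p) (map fst w) # T', ((s @ [q]) @ y) # U')"
        "length ((s @ [q]) @ y) = length (foldl row_insert (row_insert r p) (map fst w))"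
        "set y \<subseteq> snd ` set w"
        by blast
      then show ?thesis
        using biletter_insert_append[OF le Cons.prems(2), of T U q]
        by (intro exI[of _ T'] exI[of _ "q # y"] exI[of _ U'])
           (auto simp: b row_insert_snoc[OF le] simp del: biletter_insert.simps)
    next
      case (Cons p' z)
      have len: "length s = length (row_insert r p)"
        using Cons.prems(2) length_row_insert_bump[OF Cons] by simp
      from Cons.IH[OF sorted_row_insert[OF Cons.prems(1), of p] len, of "tableau_insert T p'" "add_box (tableau_insert T p') U q"]
      obtain T' y U' where
        "foldl biletter_insert (row_insert r p # tableau_insert T p', s # add_box (tableau_insert T p') U q) w =
           (foldl row_insert (row_insert r p) (map fst w) # T', (s @ y) # U')"
        "length (s @ y) = length (foldl row_insert (row_insert r p) (map fst w))"
        "set y \<subseteq> snd ` set w"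
        by auto
      then show ?thesis
        using biletter_insert_bump[OF Cons.prems(1) Cons Cons.prems(2), of T U q]
        by (intro exI[of _ T'] exI[of _ y] exI[of _ U']) (auto simp: b simp del: biletter_insert.simps)
    qed
  qed simp
  then show thesis using that by blast
qed

section \<open>Insertion with one additional letter\<close>

lemma insort_eq_Cons: "\<forall>b\<in>set ys. k \<le> b \<Longrightarrow> insort k ys = k # (ys::nat list)"
  by (cases ys) auto

lemma takeWhile_insort:
  "sorted r \<Longrightarrow> takeWhile (\<lambda>a. a \<le> p) (insort k r) =
    (if k \<le> p then insort k (takeWhile (\<lambda>a. a \<le> p) r) else takeWhile (\<lambda>a. a \<le> (p::nat)) r)"
  by (induction r) auto

lemma dropWhile_insort:
  "sorted r \<Longrightarrow> dropWhile (\<lambda>a. a \<le> p) (insort k r) =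
    (if k \<le> p then dropWhile (\<lambda>a. a \<le> p) r else insort k (dropWhile (\<lambda>a. a \<le> (p::nat)) r))"
  by (induction r) auto

lemma insort_append_left:
  "\<forall>b\<in>set ys. k \<le> b \<Longrightarrow> insort k (xs @ ys) = insort k xs @ (ys::nat list)"
  by (induction xs) (auto simp: insort_eq_Cons)

lemma insort_append_right:
  "\<forall>b\<in>set xs. b < k \<Longrightarrow> insort k (xs @ ys) = xs @ insort k (ys::nat list)"
  by (induction xs) (auto simp: insort_eq_Cons)

text \<open>If \<open>k \<le> p\<close>, the additional \<open>k\<close> lies in the part of the row
  that insertion leaves alone. If \<open>p < k\<close>, the \<open>k\<close> already in
  \<open>r\<close> ensures that the first letter above \<open>p\<close> is at most \<open>k\<close>,
  so the same value is bumped with or without the additional \<open>k\<close>.\<close>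

lemma row_insert_insort:
  assumes "sorted r" "p < k \<longrightarrow> k \<in> set r"
  shows "row_insert (insort k r) p = insort k (row_insert r p)"
    and "dropWhile (\<lambda>a. a \<le> p) (insort k r) = [] \<longleftrightarrow> dropWhile (\<lambda>a. a \<le> p) r = []"
    and "dropWhile (\<lambda>a. a \<le> p) r \<noteq> [] \<Longrightarrow> hd (dropWhile (\<lambda>a. a \<le> p) (insort k r)) = hd (dropWhile (\<lambda>a. a \<le> p) r)"
proof -
  obtain x z where r: "r = x @ z" "\<forall>a\<in>set x. a \<le> p" "\<forall>a\<in>set z. p < a"
    "takeWhile (\<lambda>a. a \<le> p) r = x" "dropWhile (\<lambda>a. a \<le> p) r = z" "sorted x" "sorted z"
    using sorted_split_le[OF assms(1), of p] by metis
  have tz: "set (tl z) \<subseteq> set z" by (cases z) auto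
  have *: "row_insert (insort k r) p = insort k (row_insert r p) \<and>
    (dropWhile (\<lambda>a. a \<le> p) (insort k r) = [] \<longleftrightarrow> z = []) \<and>
    (z \<noteq> [] \<longrightarrow> hd (dropWhile (\<lambda>a. a \<le> p) (insort k r)) = hd z)"
  proof (cases "k \<le> p")
    case True
    have "\<forall>b\<in>set (p # tl z). k \<le> b" using True r(3) tz by fastforce
    from insort_append_left[OF this, of x] show ?thesis
      using True by (simp add: row_insert_def takeWhile_insort dropWhile_insort assms(1) r(4,5))
  next
    case False
    then have "k \<in> set z" using assms(2) r(1,2) by auto
    then obtain p' y where z: "z = p' # y" by (cases z) auto
    have p': "p' \<le> k" "\<forall>b\<in>set y. p' \<le> b" using \<open>k \<in> set z\<close> r(7) by (auto simp: z)
    have ins: "insort k z = p' # insort k y"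
      using p' insort_eq_Cons[of y k] by (auto simp: z)
    have "\<forall>b\<in>set (x @ [p]). b < k" using False r(2) by auto
    from insort_append_right[OF this, of y] show ?thesis
      using False ins by (simp add: row_insert_def takeWhile_insort dropWhile_insort assms(1) r(4,5) z)
  qed
  then show "row_insert (insort k r) p = insort k (row_insert r p)"
    "dropWhile (\<lambda>a. a \<le> p) (insort k r) = [] \<longleftrightarrow> dropWhile (\<lambda>a. a \<le> p) r = []"
    "dropWhile (\<lambda>a. a \<le> p) r \<noteq> [] \<Longrightarrow> hd (dropWhile (\<lambda>a. a \<le> p) (insort k r)) = hd (dropWhile (\<lambda>a. a \<le> p) r)"
    by (simp_all add: r(5))
qed

text \<open>Both runs bump the same letters, so their lower rows agree and the additional
  \<open>l\<close> keeps its place after \<open>s0\<close>. The bound on \<open>w\<close> is an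
  invariant: a letter below \<open>k\<close> uses up at most one \<open>k\<close> of the row, so a
  \<open>k\<close> is present whenever such a letter arrives.\<close>

lemma foldl_biletter_insert_insort:
  assumes "sorted r" "length (s0 @ s1) = length r"
    and "length (filter (\<lambda>a. a < k) (map fst w)) \<le> count_list r k"
  obtains T' y U' where
    "foldl biletter_insert (r # T, (s0 @ s1) # U) w =
      (foldl row_insert r (map fst w) # T', (s0 @ s1 @ y) # U')"
    "foldl biletter_insert (insort k r # T, (s0 @ l # s1) # U) w =
      (insort k (foldl row_insert r (map fst w)) # T', (s0 @ l # s1 @ y) # U')"
    "length (s0 @ s1 @ y) = length (foldl row_insert r (map fst w))" "set y \<subseteq> snd ` set w"
proof -
  have "\<exists>T' y U'.
    foldl biletter_insert (r # T, (s0 @ s1) # U) w =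
      (foldl row_insert r (map fst w) # T', (s0 @ s1 @ y) # U') \<and>
    foldl biletter_insert (insort k r # T, (s0 @ l # s1) # U) w =
      (insort k (foldl row_insert r (map fst w)) # T', (s0 @ l # s1 @ y) # U') \<and>
    length (s0 @ s1 @ y) = length (foldl row_insert r (map fst w)) \<and> set y \<subseteq> snd ` set w"
    using assms
  proof (induction w arbitrary: r s1 T U)
    case (Cons b w)
    obtain p q where b: "b = (p, q)" by force
    note prems = Cons.prems
    \<comment> \<open>A letter \<open>p < k\<close> is itself counted on the left of the bound, so
      the row contains at least one \<open>k\<close>.\<close>
    have k: "p < k \<longrightarrow> k \<in> set r"
      by (rule impI, rule ccontr) (use prems(3) in \<open>simp add: b\<close>)
    have cnt: "length (filter (\<lambda>a. a < k) (map fst w)) \<le> count_list (row_insert r p) k"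
      using prems(3) count_list_row_insert[OF prems(1), of k p] by (auto simp: b split: if_splits)
    have srt: "sorted (row_insert r p)" "sorted (insort k r)"
      using prems(1) by (simp_all add: sorted_row_insert sorted_insort)
    have len': "length (s0 @ l # s1) = length (insort k r)" using prems(2) by simp
    show ?case
    proof (cases "dropWhile (\<lambda>a. a \<le> p) r")
      case Nil
      then have le: "\<forall>a\<in>set r. a \<le> p" by (simp only: dropWhile_le_Nil)
      have le': "\<forall>a\<in>set (insort k r). a \<le> p"
        using Nil row_insert_insort(2)[OF prems(1) k] by (simp only: dropWhile_le_Nil)
      have eq: "row_insert r p = r @ [p]" "insort k r @ [p] = insort k (row_insert r p)"
        using row_insert_insort(1)[OF prems(1) k] by (simp_all add: row_insert_snoc le le')
      have len: "length (s0 @ s1 @ [q]) = length (row_insert r p)" using prems(2) eq by simp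
      from Cons.IH[OF srt(1) len cnt, of T U] obtain T' y U' where
        "foldl biletter_insert (row_insert r p # T, (s0 @ s1 @ [q]) # U) w =
           (foldl row_insert (row_insert r p) (map fst w) # T', (s0 @ (s1 @ [q]) @ y) # U')"
        "foldl biletter_insert (insort k (row_insert r p) # T, (s0 @ l # s1 @ [q]) # U) w =
           (insort k (foldl row_insert (row_insert r p) (map fst w)) # T', (s0 @ l # (s1 @ [q]) @ y) # U')"
        "length (s0 @ (s1 @ [q]) @ y) = length (foldl row_insert (row_insert r p) (map fst w))"
        "set y \<subseteq> snd ` set w"
        by auto
      then show ?thesis
        using biletter_insert_append[OF le prems(2), of T U q] biletter_insert_append[OF le' len', of T U q]
        unfolding eq(2)
        by (intro exI[of _ T'] exI[of _ "q # y"] exI[of _ U'])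
           (auto simp: b eq(1)[symmetric] simp del: biletter_insert.simps)
    next
      case (Cons p' z)
      obtain z' where z': "dropWhile (\<lambda>a. a \<le> p) (insort k r) = p' # z'"
        using row_insert_insort(2,3)[OF prems(1) k] Cons
        by (cases "dropWhile (\<lambda>a. a \<le> p) (insort k r)") auto
      have len: "length (s0 @ s1) = length (row_insert r p)"
        using prems(2) length_row_insert_bump[OF Cons] by simp
      from Cons.IH[OF srt(1) len cnt, of "tableau_insert T p'" "add_box (tableau_insert T p') U q"]
      obtain T' y U' where
        "foldl biletter_insert (row_insert r p # tableau_insert T p', (s0 @ s1) # add_box (tableau_insert T p') U q) w =
           (foldl row_insert (row_insert r p) (map fst w) # T', (s0 @ s1 @ y) # U')"
        "foldl biletter_insert (insort k (row_insert r p) # tableau_insert T p', (s0 @ l # s1) # add_box (tableau_insert T p') U q) w =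
           (insort k (foldl row_insert (row_insert r p) (map fst w)) # T', (s0 @ l # s1 @ y) # U')"
        "length (s0 @ s1 @ y) = length (foldl row_insert (row_insert r p) (map fst w))"
        "set y \<subseteq> snd ` set w"
        by auto
      then show ?thesis
        using biletter_insert_bump[OF prems(1) Cons prems(2), of T U q]
          biletter_insert_bump[OF srt(2) z' len', of T U q] row_insert_insort(1)[OF prems(1) k]
        by (intro exI[of _ T'] exI[of _ y] exI[of _ U']) (auto simp: b simp del: biletter_insert.simps)
    qed
  qed simp
  then show thesis using that by blast
qed

text \<open>Placing a \<open>k\<close> before, between or after the equal letters gives the same
  list. This freedom allows one position \<open>c\<close> to be used for both tableaux.\<close>

lemma insort_eq_take_drop:
  assumes "sorted r" "length (filter (\<lambda>a. a < k) r) \<le> c" "c \<le> length (filter (\<lambda>a. a \<le> (k::nat)) r)"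
  shows "insort k r = take c r @ k # drop c r"
  using assms
proof (induction r arbitrary: c)
  case (Cons y ys)
  show ?case
  proof (cases c)
    case 0
    then have "\<forall>b\<in>set (y # ys). k \<le> b"
      using Cons.prems(2) by (auto simp: filter_empty_conv not_less split: if_splits)
    then show ?thesis by (simp add: 0)
  next
    case (Suc c')
    have y: "y \<le> k"
    proof (rule ccontr)
      assume "\<not> y \<le> k"
      then have "filter (\<lambda>a. a \<le> k) (y # ys) = []" using Cons.prems(1) by (auto simp: filter_empty_conv)
      then show False using Cons.prems(3) Suc by simp
    qed
    have "insort k (y # ys) = y # insort k ys"
      using y Cons.prems(1) by (auto simp: insort_eq_Cons)
    moreover have "insort k ys = take c' ys @ k # drop c' ys"
    proof (rule Cons.IH)
      show "length (filter (\<lambda>a. a < k) ys) \<le> c'"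
      proof (cases "y < k")
        case False
        then have "filter (\<lambda>a. a < k) ys = []" using Cons.prems(1) y by (auto simp: filter_empty_conv)
        then show ?thesis by simp
      qed (use Cons.prems(2) Suc in auto)
    qed (use Cons.prems Suc y in auto)
    ultimately show ?thesis using Suc by simp
  qed
qed simp

section \<open>Bitableaux\<close>

lemma transpose_long_first_row:
  assumes "\<forall>t\<in>set T. length t \<le> length r"
  shows "List.transpose (r # T) = map (\<lambda>i. r ! i # [t ! i. t \<leftarrow> T, i < length t]) [0..<length r]"
proof -
  have "foldr (\<lambda>t. max (length t)) T 0 \<le> length r" using assms by (induction T) auto
  then have "length (List.transpose (r # T)) = length r" by (simp add: length_transpose)
  moreover have "concat (map (\<lambda>t. if P t then [f t] else []) T) = map f (filter P T)" for P and f :: "'a list \<Rightarrow> 'a"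
    by (induction T) auto
  ultimately show ?thesis by (intro nth_equalityI) (auto simp: nth_transpose)
qed

text \<open>From position \<open>c\<close> on all columns have height one, so shifting the tail of
  the first row does not change what stands below any letter.\<close>

lemma transpose_insert_column:
  assumes "\<forall>t\<in>set T. length t \<le> c" "c \<le> length r"
  shows "List.transpose ((take c r @ k # drop c r) # T) =
    take c (List.transpose (r # T)) @ [k] # drop c (List.transpose (r # T))"
proof -
  have 1: "\<forall>t\<in>set T. length t \<le> length r" "\<forall>t\<in>set T. length t \<le> length (take c r @ k # drop c r)"
    using assms by fastforce+
  define g where "g i = [t ! i. t \<leftarrow> T, i < length t]" for i
  have g: "g i = []" if "c \<le> i" for i
    unfolding g_def using assms(1) that by fastforce
  let ?r = "take c r @ k # drop c r"
  have "map (\<lambda>i. ?r ! i # g i) [0..<length ?r] =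
    take c (map (\<lambda>i. r ! i # g i) [0..<length r]) @ [k] # drop c (map (\<lambda>i. r ! i # g i) [0..<length r])"
    (is "?L = ?R")
  proof (rule nth_equalityI)
    show "length ?L = length ?R" using assms(2) by simp
    fix i assume i: "i < length ?L"
    consider "i < c" | "i = c" | j where "i = Suc j" "c \<le> j"
      by (metis Suc_le_D Suc_leI not_less_eq_eq linorder_neqE_nat)
    then show "?L ! i = ?R ! i"
    proof cases
      case 3
      then show ?thesis using i assms(2) by (simp add: nth_append g Suc_diff_le del: upt_Suc)
    qed (use i assms(2) in \<open>simp_all add: nth_append g del: upt_Suc\<close>)
  qed
  then show ?thesis
    unfolding transpose_long_first_row[OF 1(1)] transpose_long_first_row[OF 1(2)] g_def .
qed

text \<open>With the same \<open>c\<close> in both tableaux, the new columns \<open>[k]\<close> and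
  \<open>[l]\<close> are paired and give a minor of size one; all other pairs of columns are
  preserved.\<close>

lemma bitableau_insert_column:
  assumes "length s = length r" "c \<le> length r"
    and "\<forall>t\<in>set T. length t \<le> c" "\<forall>t\<in>set U. length t \<le> c"
  shows "bitableau ((take c r @ k # drop c r) # T) ((take c s @ l # drop c s) # U) =
    zvar k l * bitableau (r # T) (s # U)"
proof -
  define A where "A = List.transpose (r # T)"
  define B where "B = List.transpose (s # U)"
  have len: "length A = length B"
    using assms transpose_long_first_row[of T r] transpose_long_first_row[of U s]
    unfolding A_def B_def by fastforce
  have "minor [k] [l] = zvar k l" by (simp add: minor_def det_single)
  then have "prod_list (map2 minor (take c A @ [k] # drop c A) (take c B @ [l] # drop c B)) =
    zvar k l * (prod_list (map2 minor (take c A) (take c B)) * prod_list (map2 minor (drop c A) (drop c B)))"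
    by (simp add: len)
  also have "prod_list (map2 minor (take c A) (take c B)) * prod_list (map2 minor (drop c A) (drop c B)) =
    prod_list (map2 minor (take c A @ drop c A) (take c B @ drop c B))"
    by (subst zip_append) (simp_all add: len)
  finally show ?thesis
    using assms transpose_insert_column[of T c r k] transpose_insert_column[of U c s l]
    by (simp add: bitableau_def A_def B_def)
qed

text \<open>
  Starting from empty first rows avoids a case distinction on the empty tableau; the bitableau of
  the empty word is unchanged, since the transpose of \<open>[[]]\<close> is \<open>[]\<close>.
\<close>

lemma bitableau_rsk:
  "(case rsk m n \<alpha> of (P, Q) \<Rightarrow> bitableau P Q) =
    (case foldl biletter_insert ([[]], [[]]) (biword m n \<alpha>) of (P, Q) \<Rightarrow> bitableau P Q)"
proof (cases "biword m n \<alpha>")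
  case Nil
  then show ?thesis by (simp add: rsk_def bitableau_def)
next
  case (Cons b w)
  then show ?thesis by (cases b) (simp add: rsk_def)
qed

text \<open>In the application \<open>W1\<close> and \<open>W4\<close> come from the matrix columns
  before and after column \<open>l\<close>, and \<open>U\<close> and \<open>V\<close> from the
  entries of column \<open>l\<close> above and below row \<open>k\<close>. The assumption
  \<open>dom\<close> is then the degree bound.\<close>

lemma bitableau_insert_letter:
  fixes k l N :: nat and W1 U V W4 :: "(nat \<times> nat) list"
  defines "w \<equiv> W1 @ U @ replicate N (k, l) @ V @ W4"
  assumes U: "\<forall>b\<in>set U. fst b < k \<and> snd b = l" and V: "\<forall>b\<in>set V. k < fst b \<and> snd b = l"
    and srt: "sorted (map fst (U @ replicate N (k, l) @ V))"
    and dom: "length w \<le> count_list (map fst w) k + length (U @ replicate N (k, l) @ V)"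
  shows "(case foldl biletter_insert ([[]], [[]]) (W1 @ U @ replicate (Suc N) (k, l) @ V @ W4)
      of (P, Q) \<Rightarrow> bitableau P Q) =
    zvar k l * (case foldl biletter_insert ([[]], [[]]) w of (P, Q) \<Rightarrow> bitableau P Q)"
proof -
  note sfr = sorted_foldl_row_insert
  define W2 where "W2 = U @ replicate N (k, l)"
  define r1 where "r1 = foldl row_insert [] (map fst W1)"
  define ru where "ru = foldl row_insert r1 (map fst U)"
  define r2 where "r2 = foldl row_insert r1 (map fst W2)"
  define r3 where "r3 = foldl row_insert r2 (map fst V)"
  define r4 where "r4 = foldl row_insert r3 (map fst W4)"
  have sorted: "sorted r1" "sorted ru" "sorted r2" "sorted r3" "sorted r4"
    by (simp_all add: r1_def ru_def r2_def r3_def r4_def sfr)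
  have r2_ru: "r2 = foldl row_insert ru (replicate N k)"
    by (simp add: r2_def ru_def W2_def)

  have cl: "count_list xs k + length (filter (\<lambda>a. k < a) xs) \<le> length xs"
    "count_list xs k + length (filter (\<lambda>a. a < k) xs) \<le> length xs" for xs
    by (induction xs) auto
  have "count_list (map fst U) k = 0" "count_list (map fst V) k = 0"
    "count_list (replicate N k) k = N"
    using U V by (auto simp: count_list_0_iff) (induction N, auto)
  \<comment> \<open>Column \<open>l\<close> cancels in \<open>dom\<close> except for its
    \<open>N\<close> letters \<open>k\<close>. Hence \<open>W1\<close> and \<open>W4\<close>
    together have at most \<open>N\<close> letters other than \<open>k\<close>.\<close>
  then have "length W1 + length W4 \<le> count_list (map fst W1) k + N + count_list (map fst W4) k"
    using dom by (simp add: w_def)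
  then have gt1: "length (filter (\<lambda>a. k < a) (map fst W1)) \<le> N"
    and lt4: "length (filter (\<lambda>a. a < k) (map fst W4)) \<le> N"
    using cl[of "map fst W1"] cl[of "map fst W4"] by auto

  have "length (filter (\<lambda>a. k < a) r1) \<le> length (filter (\<lambda>a. k < a) (map fst W1))"
    using length_filter_gt_foldl[of "[]" k "map fst W1"] by (simp add: r1_def)
  moreover have "filter (\<lambda>a. k < a) (map fst U) = []" using U by (auto simp: filter_empty_conv)
  then have "length (filter (\<lambda>a. k < a) ru) \<le> length (filter (\<lambda>a. k < a) r1)"
    using length_filter_gt_foldl[OF sorted(1), of k "map fst U"] by (simp add: ru_def)
  \<comment> \<open>The at most \<open>N\<close> letters above \<open>k\<close> that are left after
    \<open>U\<close> are all bumped by the \<open>N\<close> copies of \<open>k\<close>.\<close>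
  ultimately have "length (filter (\<lambda>a. k < a) r2) = 0"
    using gt1 foldl_row_insert_replicate(1)[OF sorted(2), where k = k and N = N] by (simp add: r2_ru)
  then have r2_le: "\<forall>a\<in>set r2. a \<le> k" by (simp add: filter_empty_conv not_less)
  have cnt2: "N \<le> count_list r2 k"
    using foldl_row_insert_replicate(2)[OF sorted(2), where k = k and N = N] by (simp add: r2_ru)
  have V0: "filter (\<lambda>a. a < k) (map fst V) = []" using V by (auto simp: filter_empty_conv)
  have cnt3: "N \<le> count_list r3 k"
    using cnt2 count_list_foldl[OF sorted(3), of k "map fst V"] by (simp add: r3_def V0)

  obtain T1 s1 U1 where st1: "foldl biletter_insert ([[]], [[]]) W1 = (r1 # T1, s1 # U1)"
    "length s1 = length r1"
    by (rule foldl_biletter_insert_first_row[of "[]" "[]" "[]" "[]" W1]) (auto simp: r1_def)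
  obtain T2 y2 U2 where st2: "foldl biletter_insert (r1 # T1, s1 # U1) W2 = (r2 # T2, (s1 @ y2) # U2)"
    "length (s1 @ y2) = length r2" "set y2 \<subseteq> snd ` set W2"
    by (rule foldl_biletter_insert_first_row[OF sorted(1) st1(2), of T1 U1 W2]) (auto simp: r2_def)
  \<comment> \<open>The additional biletter is taken to be the last copy of \<open>(k, l)\<close>.
    It is appended to both first rows, and at the end of a row with no letter above \<open>k\<close>
    this is \<open>insort k\<close>.\<close>
  have st2': "foldl biletter_insert (r1 # T1, s1 # U1) (W2 @ [(k, l)]) = (insort k r2 # T2, ((s1 @ y2) @ l # []) # U2)"
    using biletter_insert_append[OF r2_le st2(2), of T2 U2 l] sorted_insort_is_snoc[OF sorted(3) r2_le]
    by (simp add: st2(1) del: biletter_insert.simps)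
  have V0': "length (filter (\<lambda>a. a < k) (map fst V)) \<le> count_list r2 k" by (simp only: V0) simp
  have len2: "length ((s1 @ y2) @ []) = length r2" using st2(2) by simp
  obtain T3 y3 U3 where st3: "foldl biletter_insert (r2 # T2, ((s1 @ y2) @ []) # U2) V = (r3 # T3, ((s1 @ y2) @ [] @ y3) # U3)"
    "foldl biletter_insert (insort k r2 # T2, ((s1 @ y2) @ l # []) # U2) V = (insort k r3 # T3, ((s1 @ y2) @ l # [] @ y3) # U3)"
    "length ((s1 @ y2) @ [] @ y3) = length r3" "set y3 \<subseteq> snd ` set V"
    unfolding r3_def by (rule foldl_biletter_insert_insort[OF sorted(3) len2 V0', of T2 U2 l])
  have len3: "length ((s1 @ y2) @ y3) = length r3" using st3(3) by simp
  obtain T4 y4 U4 where st4: "foldl biletter_insert (r3 # T3, ((s1 @ y2) @ y3) # U3) W4 = (r4 # T4, ((s1 @ y2) @ y3 @ y4) # U4)"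
    "foldl biletter_insert (insort k r3 # T3, ((s1 @ y2) @ l # y3) # U3) W4 = (insort k r4 # T4, ((s1 @ y2) @ l # y3 @ y4) # U4)"
    "length ((s1 @ y2) @ y3 @ y4) = length r4"
    unfolding r4_def by (rule foldl_biletter_insert_insort[OF sorted(4) len3 order_trans[OF lt4 cnt3], of T3 U3 l])

  define s where "s = s1 @ y2 @ y3 @ y4"
  have fin: "foldl biletter_insert ([[]], [[]]) w = (r4 # T4, s # U4)"
    using st1 st2 st3 st4 by (simp add: w_def s_def W2_def)
  have "W1 @ U @ replicate (Suc N) (k, l) @ V @ W4 = W1 @ (W2 @ [(k, l)]) @ V @ W4"
    by (simp add: W2_def replicate_append_same[symmetric])
  then have fin': "foldl biletter_insert ([[]], [[]]) (W1 @ U @ replicate (Suc N) (k, l) @ V @ W4) =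
      (insort k r4 # T4, (s1 @ y2 @ l # y3 @ y4) # U4)"
    using st2' st3(2) st4(2)
    by (simp only: foldl_append[where xs = W1] foldl_append[where xs = "W2 @ _"] foldl_append[where xs = V]
      st1(1)) simp
  have len: "length s = length r4" using st4(3) by (simp add: s_def)

  \<comment> \<open>\<open>a\<close> is the last position at which \<open>k\<close> may be put into
    \<open>r4\<close>, and \<open>b\<close> the last one at which \<open>l\<close> may be put behind
    the labels of column \<open>l\<close> in the first row of \<open>Q\<close>. Their minimum will
    be the common column.\<close>
  define a where "a = length (filter (\<lambda>a. a \<le> k) r4)"
  define b where "b = length (s1 @ y2 @ y3)"
  define c where "c = min a b"
  have r4_w: "r4 = foldl row_insert [] (map fst w)"
    by (simp add: r1_def r2_def r3_def r4_def w_def W2_def)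
  have a: "count_list (map fst w) k \<le> a"
    using length_filter_le_foldl[of "[]" k "map fst w"] by (simp add: r4_w a_def)
  have a_r4: "a \<le> length r4" by (simp add: a_def)
  \<comment> \<open>The sum of the letters serves merely as a bound for each of them.\<close>
  have "length (map fst (U @ replicate N (k, l) @ V)) \<le>
      length (filter (\<lambda>x. x \<le> sum_list (map fst (U @ replicate N (k, l) @ V))) r3)"
    using length_foldl_row_insert_sorted[OF sorted(1) srt, of "sum_list (map fst (U @ replicate N (k, l) @ V))"]
    by (simp add: r3_def r2_def W2_def member_le_sum_list del: sum_list_append)
  also have "\<dots> \<le> b" using len3 by (simp add: b_def)
  finally have b: "length (U @ replicate N (k, l) @ V) \<le> b" by simp
  have b_r4: "b \<le> length r4" using st4(3) by (simp add: b_def)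

  have "(\<Sum>t\<leftarrow>r4 # T4. length t) = length w"
    using sum_length_biletter_insert[of "[[]]" "[[]]" w] by (simp add: fin)
  \<comment> \<open>By \<open>dom\<close> there are at most \<open>a + b\<close> boxes, and the
    first row takes at least \<open>max a b\<close> of them; \<open>min a b\<close> remain for the
    lower rows.\<close>
  then have "sum_list (map length T4) \<le> c"
    using a b a_r4 b_r4 dom by (simp add: c_def)
  moreover have "length t \<le> sum_list (map length T4)" if "t \<in> set T4" for t
    using that by (intro member_le_sum_list) simp_all
  ultimately have T4: "\<forall>t\<in>set T4. length t \<le> c" by (blast intro: order_trans)
  have "map length T4 = map length U4"
    using shape_biletter_insert[of "[[]]" "[[]]" w] by (simp add: fin)
  then have U4: "\<forall>t\<in>set U4. length t \<le> c"
    using T4 by (metis (no_types, lifting) image_iff list.set_map)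

  have b2: "length r2 \<le> a" "length r2 \<le> b" "length s1 \<le> length r2"
  proof -
    have "filter (\<lambda>a. a \<le> k) r2 = r2" using r2_le by simp
    then have "length r2 \<le> length (filter (\<lambda>a. a \<le> k) (foldl row_insert r2 (map fst (V @ W4))))"
      using length_filter_le_foldl[OF sorted(3), of k "map fst (V @ W4)"] by simp
    then show "length r2 \<le> a" by (simp add: a_def r3_def r4_def)
    show "length r2 \<le> b" "length s1 \<le> length r2" using st2(2) by (simp_all add: b_def)
  qed
  \<comment> \<open>At most \<open>N\<close> letters below \<open>k\<close> join after
    \<open>r2\<close>, and \<open>r2\<close> has at least \<open>N\<close> copies of
    \<open>k\<close> to make up for them. So \<open>c\<close> is not too far left for
    \<open>k\<close>.\<close>
  have "length (filter (\<lambda>a. a < k) r4) \<le> length (filter (\<lambda>a. a < k) r2) + N"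
    using lt4 length_filter_less_foldl[OF sorted(3), of k "map fst (V @ W4)"] V0
    by (simp add: r3_def r4_def)
  also have "\<dots> \<le> length r2" using cl(2)[of r2] cnt2 by simp
  finally have lt: "length (filter (\<lambda>a. a < k) r4) \<le> c" using b2 by (simp add: c_def)
  have P: "insort k r4 = take c r4 @ k # drop c r4"
    using insort_eq_take_drop[OF sorted(5) lt] by (simp add: c_def a_def)

  have "set y2 \<subseteq> {l}" "set y3 \<subseteq> {l}" using st2(3) st3(4) U V by (auto simp: W2_def)
  then obtain e f where ef: "y2 = replicate e l" "y3 = replicate f l"
    by (metis replicate_length_same singletonD subsetD)
  \<comment> \<open>Position \<open>c\<close> falls within the block \<open>y2 @ y3\<close> of
    letters \<open>l\<close> or at one of its ends, so the additional \<open>l\<close> can be moved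
    there from its place between \<open>y2\<close> and \<open>y3\<close>.\<close>
  have "length s1 \<le> c" "c \<le> length s1 + (e + f)"
    using b2 by (simp_all add: c_def b_def ef)
  then obtain g where g: "c = length s1 + g" "g \<le> e + f"
    by (auto simp: le_iff_add)
  obtain h where h: "e + f = g + h" using g(2) by (auto simp: le_iff_add)
  have "replicate e l @ replicate f l = replicate g l @ replicate h l"
    by (simp only: replicate_add[symmetric] h)
  then have shift: "replicate e l @ replicate f l @ z = replicate g l @ replicate h l @ z" for z
    by (metis append_assoc)
  have s: "s = s1 @ replicate g l @ replicate h l @ y4"
    by (simp add: s_def ef shift)
  have Q: "s1 @ y2 @ l # y3 @ y4 = take c s @ l # drop c s"
    by (simp add: s g(1) ef replicate_app_Cons_same shift)
  have "c \<le> length r4" using a_r4 by (simp add: c_def)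
  from bitableau_insert_column[OF len this T4 U4, of k l] show ?thesis
    by (simp only: fin fin' P Q prod.case)
qed

section \<open>The word of a matrix\<close>

lemma length_concat_map_upt:
  "length (concat (map f [a..<Suc b])) = (\<Sum>i=a..b. length (f i))"
  unfolding length_concat map_map comp_def interv_sum_list_conv_sum_set_nat
  by (simp only: set_upt atLeastLessThanSuc_atLeastAtMost)

lemma count_list_concat_map_upt:
  "count_list (concat (map f [a..<Suc b])) x = (\<Sum>i=a..b. count_list (f i) x)"
proof -
  have "count_list (concat xs) x = (\<Sum>t\<leftarrow>xs. count_list t x)" for xs by (induction xs) auto
  then show ?thesis
    unfolding map_map comp_def
    by (simp only: map_map comp_def interv_sum_list_conv_sum_set_nat set_upt atLeastLessThanSuc_atLeastAtMost)
qed

lemma count_list_replicate: "count_list (replicate c y) x = (if x = y then c else 0)"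
  by (induction c) auto

definition biword_column :: "nat \<Rightarrow> expo \<Rightarrow> nat \<Rightarrow> (nat \<times> nat) list" where
  "biword_column m \<alpha> j = concat [replicate (Poly_Mapping.lookup \<alpha> (i, j)) (i, j). i \<leftarrow> [1..<Suc m]]"

lemma biword_eq_concat_columns: "biword m n \<alpha> = concat (map (biword_column m \<alpha>) [1..<Suc n])"
proof -
  have "concat (concat (map f xs)) = concat (map (concat \<circ> f) xs)" for f :: "nat \<Rightarrow> (nat \<times> nat) list list" and xs
    by (induction xs) auto
  then show ?thesis unfolding biword_def biword_column_def comp_def .
qed

lemma length_biword_column: "length (biword_column m \<alpha> j) = (\<Sum>i=1..m. Poly_Mapping.lookup \<alpha> (i, j))"
  by (simp add: biword_column_def length_concat_map_upt del: upt_Suc)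

lemma length_biword: "length (biword m n \<alpha>) = (\<Sum>j=1..n. \<Sum>i=1..m. Poly_Mapping.lookup \<alpha> (i, j))"
  by (simp add: biword_eq_concat_columns length_concat_map_upt length_biword_column del: upt_Suc)

lemma count_list_biword_column:
  "k \<in> {1..m} \<Longrightarrow> count_list (map fst (biword_column m \<alpha> j)) k = Poly_Mapping.lookup \<alpha> (k, j)"
  by (simp add: biword_column_def map_concat comp_def count_list_concat_map_upt count_list_replicate sum.delta del: upt_Suc)

lemma count_list_biword:
  "k \<in> {1..m} \<Longrightarrow> count_list (map fst (biword m n \<alpha>)) k = (\<Sum>j=1..n. Poly_Mapping.lookup \<alpha> (k, j))"
  by (simp add: biword_eq_concat_columns map_concat comp_def count_list_concat_map_upt count_list_biword_column del: upt_Suc)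

lemma sorted_concat_replicate_upt: "sorted (concat (map (\<lambda>i. replicate (f i) i) [a..<b]))"
  by (induction b) (auto simp: sorted_append)

lemma upt_split: "k \<in> {a..b} \<Longrightarrow> [a..<Suc b] = [a..<k] @ k # [Suc k..<Suc b]"
  using upt_add_eq_append[of a k "Suc b - k"] by (simp add: upt_conv_Cons del: upt_Suc)

text \<open>A larger entry at \<open>(k, l)\<close> only lengthens one block of equal biletters in
  the word. Column \<open>l\<close> is read downwards, hence its row indices are sorted.\<close>

lemma bitableau_rsk_add_single:
  assumes k: "k \<in> {1..m}" and l: "l \<in> {1..n}"
    and dom: "(\<Sum>j=1..n. \<Sum>i=1..m. Poly_Mapping.lookup \<alpha> (i, j)) \<le>
      (\<Sum>j=1..n. Poly_Mapping.lookup \<alpha> (k, j)) + (\<Sum>i=1..m. Poly_Mapping.lookup \<alpha> (i, l))"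
  shows "(case rsk m n (\<alpha> + Poly_Mapping.single (k, l) 1) of (P, Q) \<Rightarrow> bitableau P Q) =
    zvar k l * (case rsk m n \<alpha> of (P, Q) \<Rightarrow> bitableau P Q)"
proof -
  define cell where "cell \<beta> i = replicate (Poly_Mapping.lookup \<beta> (i, l)) (i, l)" for \<beta> :: expo and i
  define W1 where "W1 = concat (map (biword_column m \<alpha>) [1..<l])"
  define W4 where "W4 = concat (map (biword_column m \<alpha>) [Suc l..<Suc n])"
  define U where "U = concat (map (cell \<alpha>) [1..<k])"
  define V where "V = concat (map (cell \<alpha>) [Suc k..<Suc m])"
  define N where "N = Poly_Mapping.lookup \<alpha> (k, l)"
  let ?\<beta> = "\<alpha> + Poly_Mapping.single (k, l) 1"
  have column: "biword_column m \<beta> l =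
      concat (map (cell \<beta>) [1..<k]) @ cell \<beta> k @ concat (map (cell \<beta>) [Suc k..<Suc m])" for \<beta>
    unfolding biword_column_def upt_split[OF k] cell_def by (simp del: upt_Suc)
  have split: "biword m n \<beta> = concat (map (biword_column m \<beta>) [1..<l]) @
      (concat (map (cell \<beta>) [1..<k]) @ cell \<beta> k @ concat (map (cell \<beta>) [Suc k..<Suc m])) @
      concat (map (biword_column m \<beta>) [Suc l..<Suc n])" for \<beta>
    unfolding biword_eq_concat_columns upt_split[OF l] by (simp add: column del: upt_Suc)
  have col: "biword_column m \<alpha> l = U @ replicate N (k, l) @ V"
    by (simp add: column cell_def U_def V_def N_def del: upt_Suc)
  have \<alpha>: "biword m n \<alpha> = W1 @ U @ replicate N (k, l) @ V @ W4"
    by (simp add: split W1_def W4_def U_def V_def N_def cell_def del: upt_Suc)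
  have "biword_column m ?\<beta> j = biword_column m \<alpha> j" if "j \<noteq> l" for j
    using that by (simp add: biword_column_def lookup_add lookup_single)
  then have *: "map (biword_column m ?\<beta>) [1..<l] = map (biword_column m \<alpha>) [1..<l]"
    "map (biword_column m ?\<beta>) [Suc l..<Suc n] = map (biword_column m \<alpha>) [Suc l..<Suc n]"
    by (auto simp del: upt_Suc)
  have "cell ?\<beta> i = cell \<alpha> i" if "i \<noteq> k" for i
    using that by (simp add: cell_def lookup_add lookup_single)
  then have **: "map (cell ?\<beta>) [1..<k] = map (cell \<alpha>) [1..<k]"
    "map (cell ?\<beta>) [Suc k..<Suc m] = map (cell \<alpha>) [Suc k..<Suc m]"
    by (auto simp del: upt_Suc)
  have \<beta>: "biword m n ?\<beta> = W1 @ U @ replicate (Suc N) (k, l) @ V @ W4"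
    unfolding split * ** W1_def W4_def U_def V_def N_def
    by (simp add: cell_def lookup_add del: upt_Suc)
  have "map fst (biword_column m \<alpha> l) = concat (map (\<lambda>i. replicate (Poly_Mapping.lookup \<alpha> (i, l)) i) [1..<Suc m])"
    by (simp add: biword_column_def map_concat comp_def del: upt_Suc)
  then have "sorted (map fst (U @ replicate N (k, l) @ V))"
    using sorted_concat_replicate_upt by (simp only: col)
  moreover have "\<forall>b\<in>set U. fst b < k \<and> snd b = l" "\<forall>b\<in>set V. k < fst b \<and> snd b = l"
    by (auto simp: U_def V_def cell_def simp del: upt_Suc)
  moreover have "length (biword m n \<alpha>) \<le> count_list (map fst (biword m n \<alpha>)) k + length (biword_column m \<alpha> l)"
    using dom by (simp only: length_biword count_list_biword[OF k] length_biword_column)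
  ultimately show ?thesis
    unfolding bitableau_rsk \<alpha> \<beta> col by (intro bitableau_insert_letter) auto
qed

section \<open>Weight spaces and multiplication by a variable\<close>

definition margin_matrices :: "nat \<Rightarrow> nat \<Rightarrow> (nat \<Rightarrow> nat) \<Rightarrow> (nat \<Rightarrow> nat) \<Rightarrow> expo set" where
  "margin_matrices m n \<sigma> \<pi> = {\<alpha>. Poly_Mapping.keys \<alpha> \<subseteq> {1..m} \<times> {1..n} \<and>
     (\<forall>i\<in>{1..m}. (\<Sum>j=1..n. Poly_Mapping.lookup \<alpha> (i, j)) = \<sigma> i) \<and>
     (\<forall>j\<in>{1..n}. (\<Sum>i=1..m. Poly_Mapping.lookup \<alpha> (i, j)) = \<pi> j)}"

lemma weight_space_eq_span: "weight_space m n \<sigma> \<pi> = zpoly.span (zmonom ` margin_matrices m n \<sigma> \<pi>)"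
  unfolding weight_space_def margin_matrices_def by (rule arg_cong[of _ _ zpoly.span]) blast

lemma margin_matrices_add_single_iff:
  assumes "k \<in> {1..m}" "l \<in> {1..n}"
  shows "\<alpha> + Poly_Mapping.single (k, l) 1 \<in> margin_matrices m n (add_unit \<sigma> k) (add_unit \<pi> l) \<longleftrightarrow>
    \<alpha> \<in> margin_matrices m n \<sigma> \<pi>"
proof -
  let ?e = "Poly_Mapping.single (k, l) (1::nat)"
  have "Poly_Mapping.keys (\<alpha> + ?e) = insert (k, l) (Poly_Mapping.keys \<alpha>)"
    by (auto simp: in_keys_iff lookup_add lookup_single when_def split: if_splits)
  moreover have "(\<Sum>j=1..n. Poly_Mapping.lookup ?e (i, j)) = (if i = k then 1 else 0)" for i
    using assms by (auto simp: lookup_single when_def cong: if_cong)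
  moreover have "(\<Sum>i=1..m. Poly_Mapping.lookup ?e (i, j)) = (if j = l then 1 else 0)" for j
    using assms by (auto simp: lookup_single when_def cong: if_cong)
  ultimately show ?thesis
    using assms by (auto simp: margin_matrices_def lookup_add sum.distrib add_unit_def)
qed

text \<open>Column \<open>l\<close> without its entry in row \<open>k\<close> is contained in the
  rows other than \<open>k\<close>, whose total is the degree minus
  \<open>\<sigma> k\<close>.\<close>

lemma margin_matrices_cross_le:
  assumes "\<alpha> \<in> margin_matrices m n \<sigma> \<pi>" "k \<in> {1..m}" "l \<in> {1..n}"
  shows "\<sigma> k + \<pi> l \<le> (\<Sum>i=1..m. \<sigma> i) + Poly_Mapping.lookup \<alpha> (k, l)"
proof -
  let ?a = "Poly_Mapping.lookup \<alpha>"
  have "(\<Sum>i\<in>{1..m}-{k}. ?a (i, l)) \<le> (\<Sum>i\<in>{1..m}-{k}. \<Sum>j=1..n. ?a (i, j))"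
    using assms(3) by (intro sum_mono member_le_sum) auto
  also have "\<dots> = (\<Sum>i\<in>{1..m}-{k}. \<sigma> i)"
    using assms(1) by (intro sum.cong) (auto simp: margin_matrices_def)
  finally have "(\<Sum>i\<in>{1..m}-{k}. ?a (i, l)) \<le> (\<Sum>i\<in>{1..m}-{k}. \<sigma> i)" .
  moreover have "(\<Sum>i=1..m. \<sigma> i) = \<sigma> k + (\<Sum>i\<in>{1..m}-{k}. \<sigma> i)"
    using assms(2) by (intro sum.remove) auto
  moreover have "\<pi> l = ?a (k, l) + (\<Sum>i\<in>{1..m}-{k}. ?a (i, l))"
    using assms sum.remove[of "{1..m}" k "\<lambda>i. ?a (i, l)"] by (auto simp: margin_matrices_def)
  ultimately show ?thesis by simp
qed

lemma sum_add_unit: "k \<in> {1..m} \<Longrightarrow> (\<Sum>i=1..m. add_unit \<sigma> k i) = Suc (\<Sum>i=1..m. \<sigma> i)"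
  by (simp add: add_unit_def sum.distrib)

lemma ex_add_unit: "0 < \<sigma> i \<Longrightarrow> \<exists>\<sigma>'. \<sigma> = add_unit \<sigma>' i"
  by (intro exI[of _ "\<sigma>(i := \<sigma> i - 1)"]) (auto simp: add_unit_def)

text \<open>
  Induction on \<open>d\<close>: a unit is removed from row \<open>k\<close> or column \<open>l\<close> as long as one of them is
  nonempty, so that the bound on \<open>\<sigma> k + \<pi> l\<close> persists.
\<close>

lemma ex_margin_matrix_zero_entry:
  assumes "(\<Sum>i=1..m. \<sigma> i) = d" "(\<Sum>j=1..n. \<pi> j) = d" "\<sigma> k + \<pi> l \<le> d" "k \<in> {1..m}" "l \<in> {1..n}"
  shows "\<exists>\<beta>\<in>margin_matrices m n \<sigma> \<pi>. Poly_Mapping.lookup \<beta> (k, l) = 0"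
  using assms
proof (induction d arbitrary: \<sigma> \<pi>)
  case 0
  then show ?case by (intro bexI[of _ 0]) (auto simp: margin_matrices_def)
next
  case (Suc d)
  have pos: "\<exists>i\<in>A. 0 < f i" if "0 < sum f A" for f :: "nat \<Rightarrow> nat" and A
    using that by (metis gr0I less_irrefl sum.neutral)
  have rem: "(\<Sum>i\<in>{1..m}-{k}. \<sigma> i) = Suc d - \<sigma> k" "(\<Sum>j\<in>{1..n}-{l}. \<pi> j) = Suc d - \<pi> l"
    using Suc.prems by (simp_all add: sum_diff1_nat)
  \<comment> \<open>The cell \<open>(i, j)\<close> receives the last unit. It lies in row
    \<open>k\<close> or in column \<open>l\<close> if one of these still has to be filled, so that
    \<open>\<sigma> k + \<pi> l\<close> decreases with the degree; otherwise this sum is zero and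
    stays below any bound.\<close>
  have "\<exists>i\<in>{1..m}. \<exists>j\<in>{1..n}. 0 < \<sigma> i \<and> 0 < \<pi> j \<and> (i, j) \<noteq> (k, l) \<and>
    (i = k \<or> j = l \<or> \<sigma> k + \<pi> l = 0)"
  proof (cases "\<sigma> k = 0")
    case False
    then have "0 < (\<Sum>j\<in>{1..n}-{l}. \<pi> j)" using rem Suc.prems by simp
    from pos[OF this] obtain j where "j \<in> {1..n}" "j \<noteq> l" "0 < \<pi> j" by blast
    then show ?thesis using False Suc.prems(4) by (intro bexI[of _ k] bexI[of _ j]) auto
  next
    case True
    have "0 < (\<Sum>i\<in>{1..m}. \<sigma> i)" "0 < (\<Sum>j\<in>{1..n}. \<pi> j)" using Suc.prems by simp_all
    from pos[OF this(1)] pos[OF this(2)] obtain i j where "i \<in> {1..m}" "0 < \<sigma> i" "j \<in> {1..n}" "0 < \<pi> j"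
      by blast
    then show ?thesis using True Suc.prems(5)
      by (intro bexI[of _ i] bexI[of _ "if \<pi> l = 0 then j else l"]) auto
  qed
  then obtain i j where ij: "i \<in> {1..m}" "j \<in> {1..n}" "0 < \<sigma> i" "0 < \<pi> j" "(i, j) \<noteq> (k, l)"
    "i = k \<or> j = l \<or> \<sigma> k + \<pi> l = 0"
    by (elim bexE conjE) (rule that)
  obtain \<sigma>' \<pi>' where eq: "\<sigma> = add_unit \<sigma>' i" "\<pi> = add_unit \<pi>' j"
    using ex_add_unit[of \<sigma> i] ex_add_unit[of \<pi> j] ij by blast
  have "(\<Sum>i=1..m. \<sigma>' i) = d" "(\<Sum>j=1..n. \<pi>' j) = d"
    using Suc.prems(1,2) unfolding eq sum_add_unit[OF ij(1)] sum_add_unit[OF ij(2)] by simp_all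
  moreover have "\<sigma>' k + \<pi>' l \<le> d"
    using Suc.prems(3) ij(6) by (auto simp: eq add_unit_def split: if_splits)
  ultimately have "\<exists>\<beta>\<in>margin_matrices m n \<sigma>' \<pi>'. Poly_Mapping.lookup \<beta> (k, l) = 0"
    using Suc.prems(4,5) by (rule Suc.IH)
  then obtain \<beta> where "\<beta> \<in> margin_matrices m n \<sigma>' \<pi>'" "Poly_Mapping.lookup \<beta> (k, l) = 0" by blast
  then show ?case using ij(1,2,5) margin_matrices_add_single_iff[OF ij(1,2)]
    by (intro bexI[of _ "\<beta> + Poly_Mapping.single (i, j) 1"]) (auto simp: eq lookup_add lookup_single)
qed

section \<open>Multiplication by a variable as an injective linear map\<close>

lemma scale_conv_mult: "scale c f = Poly_Mapping.single 0 c * f"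
  by (simp add: scale_def mult_map_scale_conv_mult)

lemma mult_var_linear: "Vector_Spaces.linear scale scale (mult_var k l)"
  by unfold_locales (simp_all add: mult_var_def scale_conv_mult algebra_simps)

lemma mult_var_zmonom: "mult_var k l (zmonom \<alpha>) = zmonom (\<alpha> + Poly_Mapping.single (k, l) 1)"
  by (simp add: mult_var_def zvar_def zmonom_def mult_single add.commute)

lemma zpoly_eq_sum_zmonom:
  "f = (\<Sum>\<alpha>\<in>Poly_Mapping.keys f. scale (Poly_Mapping.lookup f \<alpha>) (zmonom \<alpha>))"
  by (rule poly_mapping_eqI)
     (simp add: lookup_sum zmonom_def lookup_single when_def if_distrib[of "(*) _"] in_keys_iff cong: if_cong)

lemma mult_var_eq_sum: "mult_var k l f =
    (\<Sum>\<alpha>\<in>Poly_Mapping.keys f. scale (Poly_Mapping.lookup f \<alpha>) (zmonom (\<alpha> + Poly_Mapping.single (k, l) 1)))"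
proof -
  interpret Vector_Spaces.linear scale scale "mult_var k l" by (rule mult_var_linear)
  show ?thesis
    by (subst (1) zpoly_eq_sum_zmonom) (simp add: sum scale mult_var_zmonom)
qed

lemma lookup_mult_var_add:
  "Poly_Mapping.lookup (mult_var k l f) (\<alpha> + Poly_Mapping.single (k, l) 1) = Poly_Mapping.lookup f \<alpha>"
  by (simp add: mult_var_eq_sum lookup_sum zmonom_def lookup_single when_def if_distrib[of "(*) _"] in_keys_iff cong: if_cong)

text \<open>All exponents in a multiple of the variable have a positive entry at
  \<open>(k, l)\<close>. This detects monomials outside the image.\<close>

lemma lookup_mult_var_zero:
  assumes "Poly_Mapping.lookup \<beta> (k, l) = 0"
  shows "Poly_Mapping.lookup (mult_var k l f) \<beta> = 0"
proof -
  have "\<alpha> + Poly_Mapping.single (k, l) 1 \<noteq> \<beta>" for \<alpha>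
    using assms by (auto simp: lookup_add)
  then show ?thesis by (simp add: mult_var_eq_sum lookup_sum zmonom_def lookup_single)
qed

lemma inj_mult_var: "inj (mult_var k l)"
  by (rule injI, rule poly_mapping_eqI) (metis lookup_mult_var_add)

text \<open>A linear map sends a span to the span of the images, so surjectivity becomes a question
  about sets of matrices.\<close>

lemma mult_var_image_weight_space:
  "mult_var k l ` weight_space m n \<sigma> \<pi> =
    zpoly.span (zmonom ` (\<lambda>\<alpha>. \<alpha> + Poly_Mapping.single (k, l) 1) ` margin_matrices m n \<sigma> \<pi>)"
proof -
  interpret Vector_Spaces.linear scale scale "mult_var k l" by (rule mult_var_linear)
  show ?thesis
    unfolding weight_space_eq_span span_image[symmetric] image_image mult_var_zmonom ..
qed

lemma linear_map_mult_var:
  assumes "k \<in> {1..m}" "l \<in> {1..n}"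
  shows "linear_map (weight_space m n \<sigma> \<pi>) (weight_space m n (add_unit \<sigma> k) (add_unit \<pi> l)) (mult_var k l)"
proof -
  interpret Vector_Spaces.linear scale scale "mult_var k l" by (rule mult_var_linear)
  have "mult_var k l ` weight_space m n \<sigma> \<pi> \<subseteq> weight_space m n (add_unit \<sigma> k) (add_unit \<pi> l)"
    unfolding mult_var_image_weight_space unfolding weight_space_eq_span
    using assms by (intro zpoly.span_mono) (auto simp only: margin_matrices_add_single_iff)
  then show ?thesis by (simp add: linear_map_def add scale)
qed

lemma mult_var_RSK_op:
  assumes "(\<Sum>i=1..m. \<sigma> i) = d" "(\<Sum>j=1..n. \<pi> j) = d" "k \<in> {1..m}" "l \<in> {1..n}" "d \<le> \<sigma> k + \<pi> l"
    and f: "f \<in> weight_space m n \<sigma> \<pi>"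
  shows "mult_var k l (RSK_op m n f) = RSK_op m n (mult_var k l f)"
proof -
  interpret M: Vector_Spaces.linear scale scale "mult_var k l" by (rule mult_var_linear)
  interpret R: Vector_Spaces.linear scale scale "RSK_op m n" by (rule RSK_op_linear)
  have monom: "mult_var k l (RSK_op m n (zmonom \<alpha>)) = RSK_op m n (mult_var k l (zmonom \<alpha>))"
    if "\<alpha> \<in> margin_matrices m n \<sigma> \<pi>" for \<alpha>
  proof -
    \<comment> \<open>The sum of all entries is the degree, which puts the inequality into the form
      required for a single matrix.\<close>
    have "(\<Sum>j=1..n. \<Sum>i=1..m. Poly_Mapping.lookup \<alpha> (i, j)) = (\<Sum>j=1..n. \<pi> j)"
      using that by (intro sum.cong) (auto simp: margin_matrices_def)
    then show ?thesis
      using assms that unfolding mult_var_zmonom RSK_op_zmonom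
      by (subst bitableau_rsk_add_single) (auto simp: margin_matrices_def mult_var_def)
  qed
  show ?thesis
    using f unfolding weight_space_eq_span
    by (induction rule: zpoly.span_induct_alt) (auto simp: M.add M.scale R.add R.scale M.zero R.zero monom)
qed

theorem theorem1p5:
  fixes m n d k l :: nat and \<sigma> \<pi> :: "nat \<Rightarrow> nat"
  assumes "(\<Sum>i=1..m. \<sigma> i) = d" and "(\<Sum>j=1..n. \<pi> j) = d"
    and "k \<in> {1..m}" and "l \<in> {1..n}"
  shows "RSK_commuting m n (weight_space m n \<sigma> \<pi>)
           (weight_space m n (add_unit \<sigma> k) (add_unit \<pi> l)) (mult_var k l) \<and>
         linear_iso (weight_space m n \<sigma> \<pi>)
           (weight_space m n (add_unit \<sigma> k) (add_unit \<pi> l)) (mult_var k l)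
         \<longleftrightarrow> \<sigma> k + \<pi> l \<ge> d"
    (is "?C \<and> ?I \<longleftrightarrow> _")
proof
  let ?e = "Poly_Mapping.single (k, l) (1::nat)"
  assume "\<sigma> k + \<pi> l \<ge> d"
  have "margin_matrices m n (add_unit \<sigma> k) (add_unit \<pi> l) \<subseteq> (\<lambda>\<alpha>. \<alpha> + ?e) ` margin_matrices m n \<sigma> \<pi>"
  proof
    fix \<beta> assume \<beta>: "\<beta> \<in> margin_matrices m n (add_unit \<sigma> k) (add_unit \<pi> l)"
    \<comment> \<open>For the enlarged margins the left side of the cross inequality grows by two
      and the degree by one, which leaves at least one for the entry. Subtracting \<open>?e\<close>
      is then not truncated.\<close>
    have "0 < Poly_Mapping.lookup \<beta> (k, l)"
      using margin_matrices_cross_le[OF \<beta> assms(3,4)] assms(1) \<open>\<sigma> k + \<pi> l \<ge> d\<close>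
      unfolding sum_add_unit[OF assms(3)] by (simp add: add_unit_def)
    then have "\<beta> = (\<beta> - ?e) + ?e"
      by (intro poly_mapping_eqI) (auto simp: lookup_add lookup_minus lookup_single when_def)
    then show "\<beta> \<in> (\<lambda>\<alpha>. \<alpha> + ?e) ` margin_matrices m n \<sigma> \<pi>"
      using \<beta> margin_matrices_add_single_iff[OF assms(3,4)] by (metis imageI)
  qed
  then have "weight_space m n (add_unit \<sigma> k) (add_unit \<pi> l) \<subseteq> mult_var k l ` weight_space m n \<sigma> \<pi>"
    unfolding mult_var_image_weight_space unfolding weight_space_eq_span
    by (intro zpoly.span_mono image_mono)
  moreover note lin = linear_map_mult_var[OF assms(3,4), of \<sigma> \<pi>]
  ultimately have "mult_var k l ` weight_space m n \<sigma> \<pi> = weight_space m n (add_unit \<sigma> k) (add_unit \<pi> l)"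
    by (auto simp: linear_map_def)
  then have ?I
    using lin inj_on_subset[OF inj_mult_var] by (simp add: linear_iso_def bij_betw_def)
  then show "?C \<and> ?I"
    using lin mult_var_RSK_op[OF assms \<open>\<sigma> k + \<pi> l \<ge> d\<close>] by (simp add: RSK_commuting_def)
next
  assume "?C \<and> ?I"
  then have img: "mult_var k l ` weight_space m n \<sigma> \<pi> = weight_space m n (add_unit \<sigma> k) (add_unit \<pi> l)"
    by (simp add: linear_iso_def bij_betw_def)
  show "\<sigma> k + \<pi> l \<ge> d"
  proof (rule ccontr)
    assume "\<not> \<sigma> k + \<pi> l \<ge> d"
    \<comment> \<open>Strictness in \<open>\<sigma> k + \<pi> l < d\<close> absorbs the two added
      units: the enlarged sum is at most \<open>Suc d\<close>, the new degree.\<close>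
    then have "\<exists>\<beta>\<in>margin_matrices m n (add_unit \<sigma> k) (add_unit \<pi> l). Poly_Mapping.lookup \<beta> (k, l) = 0"
      using assms by (intro ex_margin_matrix_zero_entry[of _ _ "Suc d"]) (simp_all only: sum_add_unit, simp add: add_unit_def)
    then obtain \<beta> where \<beta>: "\<beta> \<in> margin_matrices m n (add_unit \<sigma> k) (add_unit \<pi> l)"
      "Poly_Mapping.lookup \<beta> (k, l) = 0" by blast
    have "zmonom \<beta> \<in> mult_var k l ` weight_space m n \<sigma> \<pi>"
      unfolding img unfolding weight_space_eq_span using \<beta>(1) by (intro zpoly.span_base) auto
    then show False using lookup_mult_var_zero[OF \<beta>(2)]
      by (metis imageE lookup_single_eq zero_neq_one zmonom_def)
  qed
qed

end
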